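(* Let $b,c$ be rational numbers with $\Delta\,(bc-1-b)(bc-c-2b)\neq 0$ (where $\Delta$ is as in the context), and suppose $bc^2-4bc+4b+2=0$. Then both cubic polynomials $P(x)$ and $Q(d)$ (defined in the context) are reducible over $\mathbb{Q}$; in this case $P$ has the root $x=0$ and $Q$ has the root $d=-1$.
   Context: Let $b,c$ be rational numbers. Put $\Delta=b^2c^4-6b^2c^3+13b^2c^2-12b^2c+4b^2+c^2$ and, when $\Delta\,(bc-1-b)(bc-c-2b)\neq 0$, define (with $D=b^2c^2+2b^2-3b^2c+c-bc^2+2b$): $E_{01}=-\frac{b(c^2+2-2c)}{D}$, $E_{10}=-\frac{b^2c^2+2b^2-3b^2c-c}{D}$; $E_{20}=\frac{b}{2}(bc^2-2c-2b)(2bc^2-c^2-6bc+2+4b)(bc-1-b)^{-2}(bc-c-2b)^{-2}$; $E_{02}=\frac12(28b^2c^2-16b^2c-2c^2-4b^2-b^2c^4+4b^3c^4-12b^3c^3+4bc^3+24b^3c-8bc-2b^4c^4+12b^4c^3-26b^4c^2-8b^2c^3+24b^4c-16b^3-8b^4)(bc-1-b)^{-2}(bc-c-2b)^{-2}$; $E_{03}=\frac{b}{2}(b^2c^4-5b^2c^3+10b^2c^2-10b^2c+4b^2+2bc+2c^2-bc^3)(2b^2c^4-12b^2c^3+26b^2c^2-24b^2c+8b^2-c^4b+3bc^3-6bc+4b+c^3-2c^2+2c)\,\Delta^{-1}(bc-1-b)^{-2}(bc-c-2b)^{-2}$; $E_{30}=c\,b^2(1-c)(c-2)(bc^2-4bc+2+4b)(2bc^2-c^2-4bc+2b)\,\Delta^{-1}(bc-1-b)^{-2}(bc-c-2b)^{-2}$.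 Define $P(x)=x^3-E_{10}x^2+E_{20}x-E_{30}$ and $Q(d)=d^3-E_{01}d^2+E_{02}d-E_{03}$. *)

theory Defs
  imports "HOL-Computational_Algebra.Computational_Algebra"
begin

definition Delta :: "rat \<Rightarrow> rat \<Rightarrow> rat" where
  "Delta b c = b^2*c^4 - 6*b^2*c^3 + 13*b^2*c^2 - 12*b^2*c + 4*b^2 + c^2"

text \<open>As a polynomial identity, \<open>D = (bc - 1 - b)(bc - c - 2b)\<close>, so \<open>D\<close> does not vanish
  whenever the nondegeneracy condition \<open>Delta (bc - 1 - b)(bc - c - 2b) \<noteq> 0\<close> holds, and no
  denominator below is then zero.\<close>

definition D :: "rat \<Rightarrow> rat \<Rightarrow> rat" where
  "D b c = b^2*c^2 + 2*b^2 - 3*b^2*c + c - b*c^2 + 2*b"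

definition E01 :: "rat \<Rightarrow> rat \<Rightarrow> rat" where
  "E01 b c = - (b*(c^2 + 2 - 2*c) / D b c)"

definition E10 :: "rat \<Rightarrow> rat \<Rightarrow> rat" where
  "E10 b c = - ((b^2*c^2 + 2*b^2 - 3*b^2*c - c) / D b c)"

definition E20 :: "rat \<Rightarrow> rat \<Rightarrow> rat" where
  "E20 b c =
     b/2 * (b*c^2 - 2*c - 2*b) * (2*b*c^2 - c^2 - 6*b*c + 2 + 4*b)
     / ((b*c - 1 - b)^2 * (b*c - c - 2*b)^2)"

definition E02 :: "rat \<Rightarrow> rat \<Rightarrow> rat" where
  "E02 b c =
     1/2 * (28*b^2*c^2 - 16*b^2*c - 2*c^2 - 4*b^2 - b^2*c^4 + 4*b^3*c^4 - 12*b^3*c^3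
            + 4*b*c^3 + 24*b^3*c - 8*b*c - 2*b^4*c^4 + 12*b^4*c^3 - 26*b^4*c^2
            - 8*b^2*c^3 + 24*b^4*c - 16*b^3 - 8*b^4)
     / ((b*c - 1 - b)^2 * (b*c - c - 2*b)^2)"

definition E03 :: "rat \<Rightarrow> rat \<Rightarrow> rat" where
  "E03 b c =
     b/2 * (b^2*c^4 - 5*b^2*c^3 + 10*b^2*c^2 - 10*b^2*c + 4*b^2 + 2*b*c + 2*c^2 - b*c^3)
         * (2*b^2*c^4 - 12*b^2*c^3 + 26*b^2*c^2 - 24*b^2*c + 8*b^2 - c^4*b + 3*b*c^3
            - 6*b*c + 4*b + c^3 - 2*c^2 + 2*c)
     / (Delta b c * (b*c - 1 - b)^2 * (b*c - c - 2*b)^2)"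

definition E30 :: "rat \<Rightarrow> rat \<Rightarrow> rat" where
  "E30 b c =
     c * b^2 * (1 - c) * (c - 2) * (b*c^2 - 4*b*c + 2 + 4*b) * (2*b*c^2 - c^2 - 4*b*c + 2*b)
     / (Delta b c * (b*c - 1 - b)^2 * (b*c - c - 2*b)^2)"

text \<open>Coefficients are listed from the constant term upwards:
  \<open>P(x) = x^3 - E10 x^2 + E20 x - E30\<close> and \<open>Q(d) = d^3 - E01 d^2 + E02 d - E03\<close>.\<close>

definition P :: "rat \<Rightarrow> rat \<Rightarrow> rat poly" where
  "P b c = [:- E30 b c, E20 b c, - E10 b c, 1:]"

definition Q :: "rat \<Rightarrow> rat \<Rightarrow> rat poly" where
  "Q b c = [:- E03 b c, E02 b c, - E01 b c, 1:]"

end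

theory Submission
  imports Defs
begin

text \<open>
  On the curve \<open>b c\<^sup>2 - 4 b c + 4 b + 2 = 0\<close>, that is \<open>b (c - 2)\<^sup>2 = -2\<close>, the substitution
  \<open>t = c - 2\<close>, \<open>b = -2 / t\<^sup>2\<close> makes everything factor: with \<open>s = t\<^sup>2 + 2 t + 2\<close> the three
  nondegeneracy factors become \<open>s\<^sup>2 / t\<^sup>2\<close>, \<open>- s / t\<^sup>2\<close> and \<open>- s / t\<close>, and the coefficients of
  \<open>Q\<close> become fractions with denominators \<open>s\<close> and \<open>s\<^sup>2\<close>, from which \<open>Q(-1) = 0\<close> is read off.
  \<open>P(0) = 0\<close> since the vanishing expression is a factor of \<open>E30\<close>.
\<close>

text \<open>The root splits off a linear factor; as the degree exceeds 1, the cofactor is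
  nonconstant, so neither factor is a unit.\<close>

lemma root_imp_not_irreducible:
  fixes p :: "'a::field poly"
  assumes "poly p a = 0" and "degree p > 1"
  shows "\<not> irreducible p"
proof
  assume "irreducible p"
  obtain q where q: "p = [:- a, 1:] * q"
    using assms(1) by (auto simp: poly_eq_0_iff_dvd)
  with \<open>degree p > 1\<close> have "q \<noteq> 0" by auto
  then have "degree p = 1 + degree q"
    using q by (simp add: degree_mult_eq del: mult_pCons_left)
  with \<open>degree p > 1\<close> have "\<not> is_unit q"
    by (auto simp: is_unit_iff_degree \<open>q \<noteq> 0\<close>)
  moreover have "\<not> is_unit [:- a, 1:]"
    by (simp add: is_unit_iff_degree)
  ultimately show False
    using irreducibleD[OF \<open>irreducible p\<close> q] by blast
qed

theorem theorem6p1: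
  fixes b c :: rat
  assumes "Delta b c * (b*c - 1 - b) * (b*c - c - 2*b) \<noteq> 0"
    and "b*c^2 - 4*b*c + 4*b + 2 = 0"
  shows "\<not> irreducible (P b c) \<and> \<not> irreducible (Q b c)
    \<and> poly (P b c) 0 = 0 \<and> poly (Q b c) (-1) = 0"
proof -
  have "b*c^2 - 4*b*c + 2 + 4*b = 0"
    using assms(2) by (simp add: algebra_simps)
  then have "E30 b c = 0"
    by (simp add: E30_def)
  then have P0: "poly (P b c) 0 = 0"
    by (simp add: P_def)

  define t where "t = c - 2"
  define s where "s = t^2 + 2*t + 2"
  have c: "c = t + 2" by (simp add: t_def)
  have bt: "b * t^2 = -2"
    using assms(2) by (simp add: c power2_eq_square algebra_simps)
  then have t: "t \<noteq> 0" by auto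
  have b: "b = -2 / t^2"
    using bt t by (simp add: field_simps)

  have A: "b*c - 1 - b = - s / t^2"
    unfolding b c s_def using t by (simp add: field_simps power2_eq_square)
  have B: "b*c - c - 2*b = - s / t"
    unfolding b c s_def using t by (simp add: field_simps power2_eq_square)
  have s: "s \<noteq> 0" using assms(1) B by auto
  have Delta: "Delta b c = s^2 / t^2"
    unfolding b c s_def Delta_def using t by (simp add: divide_simps; algebra)
  have D: "D b c = s^2 / t^3"
    unfolding b c s_def D_def using t by (simp add: divide_simps; algebra)
  have num01: "b*(c^2 + 2 - 2*c) = - 2 * s / t^2"
    unfolding b c s_def using t by (simp add: divide_simps; algebra)
  have E01: "E01 b c = 2 * t / s"
    unfolding E01_def D num01 using s t by (simp add: divide_simps; algebra)
  have AB: "(- s / t^2)^2 * (- s / t)^2 = s^4 / t^6"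
    using t by (simp add: divide_simps; algebra)
  have num02: "28*b^2*c^2 - 16*b^2*c - 2*c^2 - 4*b^2 - b^2*c^4 + 4*b^3*c^4 - 12*b^3*c^3
            + 4*b*c^3 + 24*b^3*c - 8*b*c - 2*b^4*c^4 + 12*b^4*c^3 - 26*b^4*c^2
            - 8*b^2*c^3 + 24*b^4*c - 16*b^3 - 8*b^4
      = 2 * s^2 * (2*t*(t+1)*(t+2) - 2*t*s - s^2) / t^6"
    \<comment> \<open>The right side is grouped for the final sum: in \<open>E02\<close>, the first
      term cancels \<open>E03\<close>, the second cancels \<open>E01\<close>, and the third leaves
      -1.\<close>
    unfolding b c s_def using t by (simp add: divide_simps; algebra)
  have E02: "E02 b c = (2*t*(t+1)*(t+2) - 2*t*s - s^2) / s^2"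
    unfolding E02_def A B AB num02 using s t by (simp add: divide_simps; algebra)
  have num03: "b^2*c^4 - 5*b^2*c^3 + 10*b^2*c^2 - 10*b^2*c + 4*b^2 + 2*b*c + 2*c^2 - b*c^3
      = 2 * s^2 * (t+1) / t^3"
    unfolding b c s_def using t by (simp add: divide_simps; algebra)
  have num03': "2*b^2*c^4 - 12*b^2*c^3 + 26*b^2*c^2 - 24*b^2*c + 8*b^2 - c^4*b + 3*b*c^3
            - 6*b*c + 4*b + c^3 - 2*c^2 + 2*c = s^2 * (t+2) / t^2"
    unfolding b c s_def using t by (simp add: divide_simps; algebra)
  have den: "s^2 / t^2 * (- s / t^2)^2 * (- s / t)^2 = s^6 / t^8"
    using t by (simp add: divide_simps; algebra)
  \<comment> \<open>The prefactor \<open>b/2\<close> is expanded last, since the left sides of the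
    preceding rewrites still contain \<open>b\<close>.\<close>
  have E03: "E03 b c = - 2 * t * (t+1) * (t+2) / s^2"
    unfolding E03_def A B Delta num03 num03' den unfolding b
    using s t by (simp add: divide_simps; algebra)

  \<comment> \<open>Equivalent to the root condition, as \<open>Q\<close> at -1 equals -1 minus this
    sum.\<close>
  have "E01 b c + E02 b c + E03 b c = -1"
    unfolding E01 E02 E03 using s by (simp add: divide_simps; algebra)
  then have Q1: "poly (Q b c) (-1) = 0"
    by (simp add: Q_def algebra_simps)

  have "degree (P b c) > 1" "degree (Q b c) > 1"
    by (simp_all add: P_def Q_def)
  then show ?thesis
    using root_imp_not_irreducible[OF P0] root_imp_not_irreducible[OF Q1] P0 Q1 by simp
qed

end
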